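(* Let $X$ be a Hausdorff compact set, $\alpha:X\to X$ a continuous map, $\lambda:C(X)\to\mathbb R$ a dynamical potential of the dynamical system $(X,\alpha)$, and $S$ its dual entropy. If $\mu\in C^*(X)$ satisfies $S(\mu)>-\infty$, then the measure $\mu$ is a probability measure and is $\alpha$-invariant. In particular, this is true for all equilibrium measures.
   Context: $C(X)$ is the space of real continuous functions on $X$ with the supremum norm; elements of $C^*(X)$ are identified with real-valued (regular) Borel measures on $X$ by the Riesz theorem. A functional $\lambda:C(X)\to\mathbb R$ is a dynamical potential of $(X,\alpha)$ if it is monotone ($\varphi\le\psi$ implies $\lambda(\varphi)\le\lambda(\psi)$), additive homogeneous ($\lambda(\varphi+t)=\lambda(\varphi)+t$ for $t\in\mathbb R$), strongly $\alpha$-invariant ($\lambda(\varphi+\psi)=\lambda(\varphi+\psi\circ\alpha)$ for all $\varphi,\psi\in C(X)$), and convex. Its dual entropy is $S(\mu)=\inf_{\varphi\in C(X)}(\lambda(\varphi)-\mu(\varphi))$, $\mu\in C^*(X)$. An equilibrium measure corresponding to $\varphi\in C(X)$ is a subgradient of $\lambda$ at $\varphi$: a linear functional $\mu:C(X)\to\mathbb R$ with $\lambda(\varphi+\psi)-\lambda(\varphi)\ge\mu(\psi)$ for all $\psi\in C(X)$. $\alpha$-invariance of $\mu$ means $\mu(\varphi\circ\alpha)=\mu(\varphi)$ for all $\varphi\in C(X)$. *)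

theory Defs
  imports "HOL-Analysis.Analysis" "HOL-Probability.Probability_Measure"
begin

text \<open>
  A compact Hausdorff space \<open>X\<close> is a type of class \<^class>\<open>t2_space\<close> whose universe is compact.
  On such a space every continuous real function is bounded, so \<open>'a \<Rightarrow>\<^sub>C real\<close> with its
  supremum norm is the space \<open>C(X)\<close>.
\<close>

text \<open>The total function below is only meaningful when \<open>\<alpha>\<close> is continuous.\<close>

definition compose_bcontfun ::
    "('a::topological_space \<Rightarrow>\<^sub>C real) \<Rightarrow> ('a \<Rightarrow> 'a) \<Rightarrow> ('a \<Rightarrow>\<^sub>C real)" where
  "compose_bcontfun \<phi> \<alpha> = Bcontfun (apply_bcontfun \<phi> \<circ> \<alpha>)"

lemma apply_compose_bcontfun:
  assumes "continuous_on UNIV \<alpha>"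
  shows "apply_bcontfun (compose_bcontfun \<phi> \<alpha>) x = apply_bcontfun \<phi> (\<alpha> x)"
proof -
  have "continuous_on UNIV (apply_bcontfun \<phi> \<circ> \<alpha>)"
    using assms by (intro continuous_on_compose) auto
  moreover have "bounded (range (apply_bcontfun \<phi> \<circ> \<alpha>))"
    by (rule bounded_subset[OF bounded_apply_bcontfun[of \<phi>]]) auto
  ultimately have "apply_bcontfun \<phi> \<circ> \<alpha> \<in> bcontfun"
    by (simp add: bcontfun_def)
  then show ?thesis
    by (simp add: compose_bcontfun_def Bcontfun_inverse)
qed

definition dynamical_potential ::
    "('a::topological_space \<Rightarrow> 'a) \<Rightarrow> (('a \<Rightarrow>\<^sub>C real) \<Rightarrow> real) \<Rightarrow> bool" where
  "dynamical_potential \<alpha> lam \<longleftrightarrow>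
     (\<forall>\<phi> \<psi>. (\<forall>x. apply_bcontfun \<phi> x \<le> apply_bcontfun \<psi> x) \<longrightarrow> lam \<phi> \<le> lam \<psi>) \<and>
     (\<forall>\<phi> t. lam (\<phi> + const_bcontfun t) = lam \<phi> + t) \<and>
     (\<forall>\<phi> \<psi>. lam (\<phi> + \<psi>) = lam (\<phi> + compose_bcontfun \<psi> \<alpha>)) \<and>
     convex_on UNIV lam"

definition dual_entropy ::
    "(('a::topological_space \<Rightarrow>\<^sub>C real) \<Rightarrow> real) \<Rightarrow> (('a \<Rightarrow>\<^sub>C real) \<Rightarrow> real) \<Rightarrow> ereal" where
  "dual_entropy lam \<mu> = (INF \<phi>. ereal (lam \<phi> - \<mu> \<phi>))"

text \<open>Only linearity is required of \<open>\<mu>\<close>, not continuity.\<close>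

definition equilibrium_measure ::
    "(('a::topological_space \<Rightarrow>\<^sub>C real) \<Rightarrow> real) \<Rightarrow> ('a \<Rightarrow>\<^sub>C real)
      \<Rightarrow> (('a \<Rightarrow>\<^sub>C real) \<Rightarrow> real) \<Rightarrow> bool" where
  "equilibrium_measure lam \<phi> \<mu> \<longleftrightarrow>
     linear \<mu> \<and> (\<forall>\<psi>. lam (\<phi> + \<psi>) - lam \<phi> \<ge> \<mu> \<psi>)"

definition invariant_functional ::
    "('a::topological_space \<Rightarrow> 'a) \<Rightarrow> (('a \<Rightarrow>\<^sub>C real) \<Rightarrow> real) \<Rightarrow> bool" where
  "invariant_functional \<alpha> \<mu> \<longleftrightarrow> (\<forall>\<phi>. \<mu> (compose_bcontfun \<phi> \<alpha>) = \<mu> \<phi>)"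

definition regular_borel_measure :: "'a::topological_space measure \<Rightarrow> bool" where
  "regular_borel_measure M \<longleftrightarrow>
     sets M = sets borel \<and>
     (\<forall>B\<in>sets borel.
        emeasure M B = (SUP K\<in>{K. K \<subseteq> B \<and> compact K}. emeasure M K) \<and>
        emeasure M B = (INF U\<in>{U. B \<subseteq> U \<and> open U}. emeasure M U))"

text \<open>
  Elements of \<open>C\<^sup>*(X)\<close> are functionals here. The identification with measures is explicit:
  \<open>\<mu>\<close> is a probability measure if it is integration against a regular Borel probability
  measure, which is moreover the only such one.
\<close>

definition is_probability_measure :: "(('a::topological_space \<Rightarrow>\<^sub>C real) \<Rightarrow> real) \<Rightarrow> bool" where
  "is_probability_measure \<mu> \<longleftrightarrow>
     (\<exists>!M. regular_borel_measure M \<and> prob_space M \<and>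
           (\<forall>\<phi>. \<mu> \<phi> = (LINT x|M. apply_bcontfun \<phi> x)))"

end

theory Submission
  imports Defs
begin

text \<open>
  Finite dual entropy means that \<open>\<mu> \<le> lam + const\<close>. On the rays through \<open>\<phi> - \<phi> \<circ> \<alpha>\<close>, through
  \<open>\<phi> \<le> 0\<close> and through the constants, \<open>lam\<close> is constant, bounded above and affine of slope 1,
  respectively, so comparing slopes at infinity shows that \<open>\<mu>\<close> is invariant, positive and
  normalized. A subgradient at \<open>\<phi>\<close> has dual entropy \<open>lam \<phi> - \<mu> \<phi>\<close>.

  The passage from positive normalized functionals to measures is the Riesz--Markov theorem: an
  open set \<open>U\<close> gets content \<open>sup {L f | 0 \<le> f \<le> 1\<^bsub>U\<^esub>}\<close>, and the Caratheodory construction applies to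
  the induced outer measure. Replacing \<open>f\<close> by \<open>max (f - e) 0\<close> costs at most \<open>e\<close> and makes the
  support compact in \<open>U\<close>.
\<close>

section \<open>Urysohn functions on compact Hausdorff spaces\<close>

text \<open>Compact Hausdorff spaces are normal, so Urysohn's lemma for abstract topologies applies
  to \<open>euclidean\<close>.\<close>

lemma Urysohn_compact_t2:
  fixes S T :: "'a::t2_space set"
  assumes "compact (UNIV :: 'a set)" "closed S" "closed T" "S \<inter> T = {}"
  obtains f :: "'a \<Rightarrow> real" where "continuous_on UNIV f" "\<And>x. 0 \<le> f x" "\<And>x. f x \<le> 1"
    "\<And>x. x \<in> S \<Longrightarrow> f x = 0" "\<And>x. x \<in> T \<Longrightarrow> f x = 1"
proof -
  have "Hausdorff_space (euclidean :: 'a topology)"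
    by (simp add: Hausdorff_space_def disjnt_def) (metis hausdorff)
  moreover have "compact_space (euclidean :: 'a topology)"
    using assms(1) by (simp add: compact_space_def)
  ultimately have "normal_space (euclidean :: 'a topology)"
    by (simp add: compact_Hausdorff_or_regular_imp_normal_space)
  then obtain f :: "'a \<Rightarrow> real" where
    f: "continuous_map euclidean (top_of_set {0..1}) f" "f ` S \<subseteq> {0}" "f ` T \<subseteq> {1}"
    using Urysohn_lemma[of euclidean S T 0 1] assms by (auto simp: disjnt_def)
  show thesis
    by (rule that[of f]) (use f in \<open>auto simp: continuous_map_in_subtopology image_subset_iff\<close>)
qed

section \<open>Positive normalized functionals\<close>

text \<open>\<open>L\<close> acts on plain functions, so that pointwise sums, products and
  truncations can be written as lambda terms. Its laws concern continuous arguments only; other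
  values are left open.\<close>

locale normalized_positive_functional =
  fixes L :: "('a::t2_space \<Rightarrow> real) \<Rightarrow> real"
  assumes compact_UNIV: "compact (UNIV :: 'a set)"
    and add: "\<And>f g. continuous_on UNIV f \<Longrightarrow> continuous_on UNIV g \<Longrightarrow>
      L (\<lambda>x. f x + g x) = L f + L g"
    and scale: "\<And>c f. continuous_on UNIV f \<Longrightarrow> L (\<lambda>x. c * f x) = c * L f"
    and nonneg: "\<And>f. continuous_on UNIV f \<Longrightarrow> (\<And>x. 0 \<le> f x) \<Longrightarrow> 0 \<le> L f"
    and one: "L (\<lambda>_. 1) = 1"
begin

lemma compact_if_closed: "closed (S :: 'a set) \<Longrightarrow> compact S"
  using compact_Int_closed[OF compact_UNIV, of S] by simp

lemma const: "L (\<lambda>_. c) = c"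
  using scale[of "\<lambda>_. 1" c] one by simp

lemma mono:
  assumes "continuous_on UNIV f" "continuous_on UNIV g" "\<And>x. f x \<le> g x"
  shows "L f \<le> L g"
proof -
  have "0 \<le> L (\<lambda>x. g x - f x)"
    using assms by (intro nonneg continuous_intros) auto
  moreover have "L (\<lambda>x. f x + (g x - f x)) = L f + L (\<lambda>x. g x - f x)"
    using assms by (intro add continuous_intros)
  ultimately show ?thesis by simp
qed

lemma sum:
  assumes "finite I" "\<And>i. i \<in> I \<Longrightarrow> continuous_on UNIV (f i)"
  shows "L (\<lambda>x. \<Sum>i\<in>I. f i x) = (\<Sum>i\<in>I. L (f i))"
  using assms
proof (induction I rule: finite_induct)
  case empty
  then show ?case by (simp add: const)
next
  case (insert i I)
  then show ?case by (simp add: add continuous_on_sum)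
qed

text \<open>Pointwise \<open>f \<le> max (f - e) 0 + e\<close>, and by normalization the constant
  contributes exactly \<open>e\<close>.\<close>

lemma le_truncate:
  assumes "continuous_on UNIV f"
  shows "L f \<le> L (\<lambda>x. max (f x - e) 0) + e"
proof -
  have "L f \<le> L (\<lambda>x. max (f x - e) 0 + e)"
    using assms by (intro mono continuous_intros) auto
  also have "\<dots> = L (\<lambda>x. max (f x - e) 0) + L (\<lambda>_. e)"
    using assms by (intro add continuous_intros)
  finally show ?thesis by (simp add: const)
qed

section \<open>Continuous functions below the indicator of a set\<close>

text \<open>Vanishing off \<open>U\<close> stands in for compact support inside \<open>U\<close>.
  The set \<open>U\<close> is arbitrary, since closed superlevel sets occur here as well as open
  sets.\<close>

definition below :: "'a set \<Rightarrow> ('a \<Rightarrow> real) set" where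
  "below U = {f. continuous_on UNIV f \<and> (\<forall>x. 0 \<le> f x \<and> f x \<le> 1) \<and> (\<forall>x. x \<notin> U \<longrightarrow> f x = 0)}"

lemma belowI:
  "continuous_on UNIV f \<Longrightarrow> (\<And>x. 0 \<le> f x) \<Longrightarrow> (\<And>x. f x \<le> 1) \<Longrightarrow> (\<And>x. x \<notin> U \<Longrightarrow> f x = 0)
    \<Longrightarrow> f \<in> below U"
  by (auto simp: below_def)

lemma belowD:
  assumes "f \<in> below U"
  shows "continuous_on UNIV f" "0 \<le> f x" "f x \<le> 1" "x \<notin> U \<Longrightarrow> f x = 0"
  using assms by (auto simp: below_def)

lemma zero_below: "(\<lambda>_. 0) \<in> below U"
  by (auto simp: below_def)

lemma L_below_nonneg: "f \<in> below U \<Longrightarrow> 0 \<le> L f"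
  by (auto intro: nonneg simp: below_def)

text \<open>Only points with \<open>f x > e\<close> survive the truncation. Later \<open>V\<close>
  is either the superlevel set itself or a finite union covering it.\<close>

lemma truncate_below:
  assumes "f \<in> below U" "0 < e" "{x. e \<le> f x} \<subseteq> V"
  shows "(\<lambda>x. max (f x - e) 0) \<in> below V"
proof (rule belowI)
  show "continuous_on UNIV (\<lambda>x. max (f x - e) 0)"
    using belowD(1)[OF assms(1)] by (intro continuous_intros)
  show "max (f x - e) 0 \<le> 1" for x
    using belowD(3)[OF assms(1), of x] assms(2) by simp
  show "max (f x - e) 0 = 0" if "x \<notin> V" for x
    using that assms(3) by force
qed simp

lemma closed_superlevel:
  assumes "f \<in> below U"
  shows "closed {x. e \<le> f x}"
  using closed_Collect_le[of "\<lambda>_. e" f] belowD(1)[OF assms] by simp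

lemma superlevel_subset:
  assumes "f \<in> below U" "0 < e"
  shows "{x. e \<le> f x} \<subseteq> U"
  using belowD(4)[OF assms(1)] assms(2) by force

section \<open>Content of open sets\<close>

definition content :: "'a set \<Rightarrow> ennreal" where
  "content U = (SUP f\<in>below U. ennreal (L f))"

lemma content_upper: "f \<in> below U \<Longrightarrow> ennreal (L f) \<le> content U"
  unfolding content_def by (rule SUP_upper)

lemma content_mono: "U \<subseteq> V \<Longrightarrow> content U \<le> content V"
  unfolding content_def by (rule SUP_subset_mono) (auto simp: below_def)

lemma content_empty: "content {} = 0"
proof -
  have "below {} = {\<lambda>_. 0}"
    using zero_below by (auto simp: below_def)
  then show ?thesis by (simp add: content_def const)
qed

lemma content_UNIV: "content UNIV = 1"
proof (rule antisym)
  show "content UNIV \<le> 1"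
    unfolding content_def
  proof (rule SUP_least)
    fix f assume "f \<in> below UNIV"
    then have "L f \<le> L (\<lambda>_. 1)"
      by (intro mono) (auto simp: below_def)
    then show "ennreal (L f) \<le> 1"
      by (simp add: one)
  qed
  show "1 \<le> content UNIV"
    using content_upper[of "\<lambda>_. 1" UNIV] by (simp add: one below_def)
qed

text \<open>A partition of unity for two sets: the truncation \<open>?h\<close> lives on the closed
  set \<open>?K\<close> inside \<open>U \<union> V\<close> and is split by a Urysohn function into a
  part below \<open>U\<close> and a part below \<open>V\<close>.\<close>

lemma content_Un:
  assumes "open U" "open V"
  shows "content (U \<union> V) \<le> content U + content V"
  unfolding content_def[of "U \<union> V"]
proof (rule SUP_least, rule ennreal_le_epsilon)
  fix f and e :: real
  assume f: "f \<in> below (U \<union> V)" and e: "0 < e"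
  let ?h = "\<lambda>x. max (f x - e) 0"
  let ?K = "{x. e \<le> f x}"
  have K: "?K \<subseteq> U \<union> V" "closed ?K"
    using superlevel_subset[OF f e] closed_superlevel[OF f] by auto
  have h: "?h \<in> below ?K"
    by (rule truncate_below[OF f e]) simp
  \<comment> \<open>As \<open>g\<close> is 0 off \<open>U\<close>, the product \<open>?h * g\<close>
    lies below \<open>U\<close>. As \<open>g\<close> is 1 on \<open>?K - V\<close> and
    \<open>?h\<close> is 0 off \<open>?K\<close>, the remainder \<open>?h * (1 - g)\<close> vanishes
    off \<open>V\<close>.\<close>
  obtain g :: "'a \<Rightarrow> real" where g: "continuous_on UNIV g" "\<And>x. 0 \<le> g x" "\<And>x. g x \<le> 1"
    "\<And>x. x \<in> - U \<Longrightarrow> g x = 0" "\<And>x. x \<in> ?K - V \<Longrightarrow> g x = 1"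
  proof (rule Urysohn_compact_t2[OF compact_UNIV, of "- U" "?K - V"])
    show "- U \<inter> (?K - V) = {}"
      using K(1) by blast
  qed (use assms K(2) in \<open>auto simp only: closed_Compl closed_Diff\<close>)
  have hU: "(\<lambda>x. ?h x * g x) \<in> below U"
    by (intro belowI continuous_on_mult belowD(1)[OF h] g(1) mult_nonneg_nonneg mult_le_one
        belowD(2,3)[OF h] g(2,3)) (simp add: g(4))
  have hV: "(\<lambda>x. ?h x * (1 - g x)) \<in> below V"
  proof (rule belowI)
    show "?h x * (1 - g x) = 0" if "x \<notin> V" for x
      using that g(5)[of x] belowD(4)[OF h, of x] by (cases "x \<in> ?K") auto
  qed (intro continuous_on_mult continuous_on_diff continuous_on_const belowD(1)[OF h] g(1)
      mult_nonneg_nonneg mult_le_one belowD(2,3)[OF h]; simp add: g(2,3))+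
  have "L ?h = L (\<lambda>x. ?h x * g x + ?h x * (1 - g x))"
    by (simp add: algebra_simps)
  also have "\<dots> = L (\<lambda>x. ?h x * g x) + L (\<lambda>x. ?h x * (1 - g x))"
    by (rule add[OF belowD(1)[OF hU] belowD(1)[OF hV]])
  finally have "L f \<le> L (\<lambda>x. ?h x * g x) + L (\<lambda>x. ?h x * (1 - g x)) + e"
    using le_truncate[OF belowD(1)[OF f], of e] by simp
  then have "ennreal (L f) \<le> ennreal (L (\<lambda>x. ?h x * g x)) + ennreal (L (\<lambda>x. ?h x * (1 - g x))) + ennreal e"
    using e L_below_nonneg[OF hU] L_below_nonneg[OF hV]
    by (simp add: ennreal_leI flip: ennreal_plus)
  also have "\<dots> \<le> content U + content V + ennreal e"
    by (intro add_mono content_upper hU hV order_refl)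
  finally show "ennreal (L f) \<le> content U + content V + ennreal e" .
qed

lemma content_UN_finite:
  assumes "finite I" "\<And>i. i \<in> I \<Longrightarrow> open (U i)"
  shows "content (\<Union>i\<in>I. U i) \<le> (\<Sum>i\<in>I. content (U i))"
  using assms
proof (induction I rule: finite_induct)
  case empty
  then show ?case by (simp add: content_empty)
next
  case (insert i I)
  have "content (U i \<union> (\<Union>i\<in>I. U i)) \<le> content (U i) + content (\<Union>i\<in>I. U i)"
    using insert by (intro content_Un open_UN) auto
  also have "\<dots> \<le> content (U i) + (\<Sum>i\<in>I. content (U i))"
    using insert by (intro add_left_mono) auto
  finally show ?case
    using insert by simp
qed

text \<open>The superlevel set of \<open>f\<close> is compact, so finitely many \<open>U i\<close>
  cover it. The truncation lies below their union, which reduces the claim to the finite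
  case.\<close>

lemma content_UN:
  fixes U :: "nat \<Rightarrow> 'a set"
  assumes "\<And>i. open (U i)"
  shows "content (\<Union>i. U i) \<le> (\<Sum>i. content (U i))"
  unfolding content_def[of "\<Union>i. U i"]
proof (rule SUP_least, rule ennreal_le_epsilon)
  fix f and e :: real
  assume f: "f \<in> below (\<Union>i. U i)" and e: "0 < e"
  let ?h = "\<lambda>x. max (f x - e) 0"
  have "compact {x. e \<le> f x}"
    by (intro compact_if_closed closed_superlevel[OF f])
  then obtain I where I: "finite I" "{x. e \<le> f x} \<subseteq> (\<Union>i\<in>I. U i)"
    using superlevel_subset[OF f e] assms by (metis compactE_image)
  have h: "?h \<in> below (\<Union>i\<in>I. U i)"
    by (rule truncate_below[OF f e I(2)])
  have "ennreal (L f) \<le> ennreal (L ?h) + ennreal e"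
    using e L_below_nonneg[OF h] le_truncate[OF belowD(1)[OF f], of e]
    by (simp add: ennreal_leI flip: ennreal_plus)
  also have "ennreal (L ?h) \<le> (\<Sum>i\<in>I. content (U i))"
    using content_upper[OF h] content_UN_finite[OF I(1)] assms order_trans by blast
  also have "\<dots> \<le> (\<Sum>i. content (U i))"
    using I(1) by (intro sum_le_suminf) auto
  finally show "ennreal (L f) \<le> (\<Sum>i. content (U i)) + ennreal e"
    by (simp add: add_right_mono)
qed

section \<open>Outer measure and Caratheodory's construction\<close>

definition outer :: "'a set \<Rightarrow> ennreal" where
  "outer A = (INF U\<in>{U. A \<subseteq> U \<and> open U}. content U)"

lemma outer_open: "open U \<Longrightarrow> outer U = content U"
  unfolding outer_def by (rule antisym) (auto intro: INF_lower INF_greatest content_mono)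

lemma outer_mono: "A \<subseteq> B \<Longrightarrow> outer A \<le> outer B"
  unfolding outer_def by (rule INF_superset_mono) auto

lemma outer_le_content: "A \<subseteq> U \<Longrightarrow> open U \<Longrightarrow> outer A \<le> content U"
  using outer_mono outer_open by metis

lemma outer_finite: "outer A < top"
  using outer_mono[of A UNIV] by (simp add: outer_open content_UNIV le_less_trans)

lemma outer_UN:
  fixes A :: "nat \<Rightarrow> 'a set"
  shows "outer (\<Union>i. A i) \<le> (\<Sum>i. outer (A i))"
proof (rule ennreal_le_epsilon)
  fix e :: real
  assume e: "0 < e"
  have "\<exists>U. A i \<subseteq> U \<and> open U \<and> content U \<le> outer (A i) + ennreal (e * (1/2) ^ Suc i)" for i
  proof -
    \<comment> \<open>The inequality is strict because \<open>outer\<close> is finite, so some open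
      superset comes this close to the infimum. The errors form a geometric series with sum
      \<open>e\<close>.\<close>
    have "outer (A i) < outer (A i) + ennreal (e * (1/2) ^ Suc i)"
      using outer_finite[of "A i"] e by (simp add: ennreal_less_zero_iff)
    then show ?thesis
      unfolding outer_def[of "A i"] INF_less_iff by (auto intro: less_imp_le)
  qed
  then obtain U where U: "\<And>i. A i \<subseteq> U i" "\<And>i. open (U i)"
      "\<And>i. content (U i) \<le> outer (A i) + ennreal (e * (1/2) ^ Suc i)"
    by metis
  have "(\<lambda>i. e * (1/2) ^ Suc i) sums (e * 1)"
    by (intro sums_mult power_half_series)
  then have half: "(\<Sum>i. ennreal (e * (1/2) ^ Suc i)) = ennreal e"
    using e by (subst suminf_ennreal_eq) auto
  have "outer (\<Union>i. A i) \<le> content (\<Union>i. U i)"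
    using U by (intro outer_le_content open_UN) auto
  also have "\<dots> \<le> (\<Sum>i. content (U i))"
    by (rule content_UN[OF U(2)])
  also have "\<dots> \<le> (\<Sum>i. outer (A i) + ennreal (e * (1/2) ^ Suc i))"
    by (intro suminf_le U(3) summableI)
  also have "\<dots> = (\<Sum>i. outer (A i)) + ennreal e"
    unfolding half[symmetric] by (rule suminf_add[symmetric]) (rule summableI)+
  finally show "outer (\<Union>i. A i) \<le> (\<Sum>i. outer (A i)) + ennreal e" .
qed

lemma outer_measure_space_outer: "outer_measure_space (Pow UNIV) outer"
  by (auto simp: outer_measure_space_def positive_def increasing_def countably_subadditive_def
      outer_open content_empty intro: outer_mono outer_UN)

text \<open>The nontrivial half of Caratheodory's criterion. Once \<open>A\<close> is enlarged to an
  open \<open>U\<close>, a function living on a closed \<open>?K\<close> inside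
  \<open>U \<inter> V\<close> and a function below \<open>U - ?K\<close> are never both nonzero, so
  their sum stays below \<open>U\<close>.\<close>

lemma outer_split:
  assumes "open V"
  shows "outer (A \<inter> V) + outer (A - V) \<le> outer A"
  unfolding outer_def[of A]
proof (rule INF_greatest)
  fix U assume "U \<in> {U. A \<subseteq> U \<and> open U}"
  then have U: "A \<subseteq> U" "open U" by auto
  \<comment> \<open>The supremum is moved outside the sum so that \<open>f\<close> is fixed before
    \<open>?K\<close> is formed from it.\<close>
  have "content (U \<inter> V) + outer (U - V) = (SUP f\<in>below (U \<inter> V). ennreal (L f) + outer (U - V))"
    unfolding content_def
    by (rule ennreal_SUP_add_left[symmetric]) (use zero_below in blast)
  also have "\<dots> \<le> content U"
  proof (rule SUP_least, rule ennreal_le_epsilon)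
    fix f and e :: real
    assume f: "f \<in> below (U \<inter> V)" and e: "0 < e"
    let ?h = "\<lambda>x. max (f x - e) 0"
    let ?K = "{x. e \<le> f x}"
    have K: "?K \<subseteq> U \<inter> V" "closed ?K"
      using superlevel_subset[OF f e] closed_superlevel[OF f] by auto
    have h: "?h \<in> below ?K"
      by (rule truncate_below[OF f e]) simp
    have "ennreal (L ?h) + content (U - ?K) = (SUP g\<in>below (U - ?K). ennreal (L ?h) + ennreal (L g))"
      unfolding content_def
      by (rule ennreal_SUP_add_right) (use zero_below in blast)
    also have "\<dots> \<le> content U"
    proof (rule SUP_least)
      fix g assume g: "g \<in> below (U - ?K)"
      have "(\<lambda>x. ?h x + g x) \<in> below U"
      proof (rule belowI)
        show "continuous_on UNIV (\<lambda>x. ?h x + g x)"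
          by (intro continuous_on_add belowD(1)[OF h] belowD(1)[OF g])
        show "?h x + g x \<le> 1" for x
          using belowD(3,4)[OF h, of x] belowD(3,4)[OF g, of x] by (cases "x \<in> ?K") auto
        show "?h x + g x = 0" if "x \<notin> U" for x
        proof -
          have "x \<notin> ?K" "x \<notin> U - ?K"
            using that K(1) by blast+
          then show ?thesis
            using belowD(4)[OF h] belowD(4)[OF g] by simp
        qed
      qed (use belowD(2)[OF h] belowD(2)[OF g] in auto)
      then have "ennreal (L (\<lambda>x. ?h x + g x)) \<le> content U"
        by (rule content_upper)
      also have "L (\<lambda>x. ?h x + g x) = L ?h + L g"
        by (intro add belowD(1)[OF h] belowD(1)[OF g])
      finally show "ennreal (L ?h) + ennreal (L g) \<le> content U"
        using L_below_nonneg[OF h] L_below_nonneg[OF g] by simp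
    qed
    finally have *: "ennreal (L ?h) + content (U - ?K) \<le> content U" .
    have "ennreal (L f) \<le> ennreal (L ?h) + ennreal e"
      using e L_below_nonneg[OF h] le_truncate[OF belowD(1)[OF f], of e]
      by (simp add: ennreal_leI flip: ennreal_plus)
    \<comment> \<open>\<open>U - ?K\<close> is an open superset of \<open>U - V\<close>, because
      \<open>?K\<close> is closed and contained in \<open>V\<close>.\<close>
    moreover have "outer (U - V) \<le> content (U - ?K)"
      using K U by (intro outer_le_content open_Diff) auto
    ultimately have "ennreal (L f) + outer (U - V) \<le> (ennreal (L ?h) + ennreal e) + content (U - ?K)"
      by (rule add_mono)
    also have "\<dots> = (ennreal (L ?h) + content (U - ?K)) + ennreal e"
      by (simp add: ac_simps)
    also have "\<dots> \<le> content U + ennreal e"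
      using * by (rule add_right_mono)
    finally show "ennreal (L f) + outer (U - V) \<le> content U + ennreal e" .
  qed
  finally have "content (U \<inter> V) + outer (U - V) \<le> content U" .
  moreover have "outer (A \<inter> V) \<le> content (U \<inter> V)"
    using U assms by (intro outer_le_content) auto
  moreover have "outer (A - V) \<le> outer (U - V)"
    using U by (intro outer_mono) auto
  ultimately show "outer (A \<inter> V) + outer (A - V) \<le> content U"
    by (meson add_mono order_trans)
qed

text \<open>The Caratheodory-measurable sets form a sigma-algebra containing the open sets, hence
  the Borel sets, and the measure restricts to these.\<close>

lemma measure_space_outer: "measure_space UNIV (sets borel) outer"
proof -
  interpret P: sigma_algebra UNIV "Pow UNIV :: 'a set set"
    by (rule sigma_algebra_Pow)
  let ?\<Lambda> = "lambda_system UNIV (Pow UNIV) outer"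
  have ms: "measure_space UNIV ?\<Lambda> outer"
    by (rule P.caratheodory_lemma[OF outer_measure_space_outer])
  then have sa: "sigma_algebra UNIV ?\<Lambda>"
    by (simp add: measure_space_def)
  have "V \<in> ?\<Lambda>" if "open V" for V
  proof -
    have "outer A \<le> outer (A \<inter> V) + outer (A - V)" for A
    proof -
      have "subadditive (Pow UNIV) outer"
        using outer_measure_space_outer P.countably_subadditive_subadditive
        by (auto simp: outer_measure_space_def)
      then have "outer ((A \<inter> V) \<union> (A - V)) \<le> outer (A \<inter> V) + outer (A - V)"
        by (rule subadditiveD) auto
      then show ?thesis by (simp add: Int_Diff_Un)
    qed
    then show ?thesis
      unfolding P.lambda_system_eq using outer_split[OF that] by (simp add: antisym)
  qed
  then have "sigma_sets UNIV {V :: 'a set. open V} \<subseteq> ?\<Lambda>"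
    by (intro sigma_algebra.sigma_sets_subset[OF sa] subsetI) simp
  then have "sets borel \<subseteq> ?\<Lambda>"
    by (simp add: borel_def)
  then show ?thesis
    by (intro measure_down[OF ms]) (simp_all add: sets.sigma_algebra_axioms flip: space_borel)
qed

section \<open>The representing measure and its regularity\<close>

definition riesz_measure :: "'a measure" where
  "riesz_measure = measure_of UNIV (sets borel) outer"

lemma sets_riesz_measure [simp, measurable_cong]: "sets riesz_measure = sets borel"
  unfolding riesz_measure_def using sets.sets_measure_of_eq[of borel] by simp

lemma space_riesz_measure [simp]: "space riesz_measure = UNIV"
  by (simp add: riesz_measure_def)

lemma emeasure_riesz_measure: "B \<in> sets borel \<Longrightarrow> emeasure riesz_measure B = outer B"
  unfolding riesz_measure_def
  using measure_space_outer
  by (intro emeasure_measure_of_sigma) (auto simp: measure_space_def)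

sublocale riesz: prob_space riesz_measure
  by standard (simp add: emeasure_riesz_measure outer_open content_UNIV)

text \<open>Outer regularity is built into \<open>outer\<close>. Inner regularity follows by
  complements: if an open \<open>U\<close> contains \<open>- B\<close> with small excess, then
  \<open>- U\<close> is a compact subset of \<open>B\<close> that misses little of it.\<close>

lemma regular_riesz_measure: "regular_borel_measure riesz_measure"
  unfolding regular_borel_measure_def
proof (intro conjI ballI)
  show outer: "emeasure riesz_measure B = (INF U\<in>{U. B \<subseteq> U \<and> open U}. emeasure riesz_measure U)"
    if "B \<in> sets borel" for B
    using that by (simp add: emeasure_riesz_measure outer_def[of B] outer_open)
  fix B :: "'a set" assume B: "B \<in> sets borel"
  show "emeasure riesz_measure B = (SUP K\<in>{K. K \<subseteq> B \<and> compact K}. emeasure riesz_measure K)"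
  proof (rule antisym)
    show "emeasure riesz_measure B \<le> (SUP K\<in>{K. K \<subseteq> B \<and> compact K}. emeasure riesz_measure K)"
    proof (rule ennreal_le_epsilon)
      fix e :: real assume e: "0 < e"
      have "emeasure riesz_measure (- B) < emeasure riesz_measure (- B) + ennreal e"
        using e by (simp add: ennreal_less_zero_iff riesz.emeasure_finite less_top)
      then obtain U where U: "- B \<subseteq> U" "open U"
        "emeasure riesz_measure U < emeasure riesz_measure (- B) + ennreal e"
        using B outer[of "- B"] by (auto simp: INF_less_iff)
      have "emeasure riesz_measure B \<le> emeasure riesz_measure (- U) + ennreal e"
      proof -
        \<comment> \<open>Real-valued probabilities allow complements to be computed by
          subtraction.\<close>
        have "riesz.prob U < riesz.prob (- B) + e"
          using U(3) e by (simp add: riesz.emeasure_eq_measure ennreal_less_iff flip: ennreal_plus)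
        moreover have "riesz.prob (- B) = 1 - riesz.prob B" "riesz.prob (- U) = 1 - riesz.prob U"
          using riesz.prob_compl[of B] riesz.prob_compl[of U] B U(2) by (auto simp: Compl_eq_Diff_UNIV)
        ultimately show ?thesis
          using e by (simp add: riesz.emeasure_eq_measure flip: ennreal_plus)
      qed
      also have "emeasure riesz_measure (- U) \<le> (SUP K\<in>{K. K \<subseteq> B \<and> compact K}. emeasure riesz_measure K)"
        using U by (intro SUP_upper) (auto intro: compact_if_closed)
      finally show "emeasure riesz_measure B
          \<le> (SUP K\<in>{K. K \<subseteq> B \<and> compact K}. emeasure riesz_measure K) + ennreal e"
        by (simp add: add_right_mono)
    qed
  qed (use B in \<open>auto intro!: SUP_least emeasure_mono\<close>)
qed simp

section \<open>Agreement of the functional with the integral\<close>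

lemma integrable_continuous:
  fixes f :: "'a \<Rightarrow> real"
  assumes "prob_space M" "sets M = sets borel" "continuous_on UNIV f"
  shows "integrable M f"
proof -
  interpret M: prob_space M by fact
  have "bounded (range f)"
    using compact_UNIV assms(3) compact_continuous_image compact_imp_bounded by blast
  then obtain b where "\<And>x. norm (f x) \<le> b"
    by (auto simp: bounded_iff)
  moreover have "f \<in> borel_measurable M"
    using borel_measurable_continuous_onI[OF assms(3)] assms(2) by (simp cong: measurable_cong_sets)
  ultimately show ?thesis
    by (intro M.integrable_const_bound[where B = b]) auto
qed

lemma L_below_le_prob:
  assumes "f \<in> below U" "open U"
  shows "L f \<le> riesz.prob U"
proof -
  have "emeasure riesz_measure U = content U"
    using assms(2) by (simp add: emeasure_riesz_measure outer_open)
  then show ?thesis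
    using content_upper[OF assms(1)] by (simp add: riesz.emeasure_eq_measure flip: ennreal_le_iff)
qed

text \<open>
  The function is cut into \<open>n\<close> horizontal slices of height \<open>1 / n\<close>. A rescaled slice \<open>s k\<close> lies
  between the indicators of \<open>{k + 1 \<le> n f}\<close> and \<open>{k < n f}\<close>, so that both \<open>L\<close> and the integral
  of \<open>f\<close> are close to the average of the measures of the superlevel sets.
\<close>

lemma L_le_integral_unit:
  assumes f: "continuous_on UNIV f" "\<And>x. 0 \<le> f x" "\<And>x. f x \<le> 1"
  shows "L f \<le> (LINT x|riesz_measure. f x)"
proof (rule field_le_epsilon)
  fix e :: real assume "0 < e"
  then obtain n :: nat where n: "0 < n" "1 / n < e"
    using nat_approx_posE[of e] by (metis zero_less_Suc)
  define s where "s k x = min (max (n * f x - real k) 0) 1" for k x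
  define p where "p k = riesz.prob {x. real k < n * f x}" for k
  have cont: "continuous_on UNIV (s k)" for k
    unfolding s_def using f by (intro continuous_intros)
  have opn: "open {x. real k < n * f x}" for k
    using f by (intro open_Collect_less continuous_intros)
  \<comment> \<open>The first \<open>m\<close> unit slices of \<open>y\<close> add up to
    \<open>y\<close> cut off at \<open>m\<close>; the cut has no effect for
    \<open>y = n * f x\<close> and \<open>m = n\<close>.\<close>
  have slices: "(\<Sum>k<m. min (max (y - real k) 0) 1) = min y m" if "0 \<le> y" for y m
    using that by (induction m) (auto simp: min_def max_def)
  have nf: "n * f x = (\<Sum>k<n. s k x)" for x
    unfolding s_def using f(2,3)[of x] by (subst slices) (auto simp: min_def mult_left_le)
  have "n * L f = L (\<lambda>x. \<Sum>k<n. s k x)"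
    using scale[OF f(1), of "real n"] by (simp add: nf)
  also have "\<dots> = (\<Sum>k<n. L (s k))"
    by (intro sum cont) simp
  also have "\<dots> \<le> (\<Sum>k<n. p k)"
    unfolding p_def
    by (intro sum_mono L_below_le_prob opn belowI cont) (auto simp: s_def)
  \<comment> \<open>The extra term \<open>p n\<close> allows a shift of the index by one. Each
    \<open>p (Suc k)\<close> is bounded by the integral of \<open>s k\<close>, and only
    \<open>p 0 \<le> 1\<close> is lost, which becomes \<open>1 / n\<close> after division.\<close>
  also have "\<dots> \<le> (\<Sum>k<Suc n. p k)"
    by (simp add: p_def)
  also have "\<dots> = p 0 + (\<Sum>k<n. p (Suc k))"
    by (rule sum.lessThan_Suc_shift)
  also have "\<dots> \<le> 1 + (\<Sum>k<n. LINT x|riesz_measure. s k x)"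
  proof (intro add_mono sum_mono)
    show "p 0 \<le> 1"
      by (simp add: p_def)
    fix k
    have "p (Suc k) = (LINT x|riesz_measure. indicator {x. real (Suc k) < n * f x} x)"
      using opn by (simp add: p_def)
    also have "\<dots> \<le> (LINT x|riesz_measure. s k x)"
    proof (rule integral_mono)
      show "integrable riesz_measure (indicator {x. real (Suc k) < n * f x} :: 'a \<Rightarrow> real)"
        using opn[of "Suc k"] riesz.emeasure_finite by (auto simp: less_top[symmetric])
      show "integrable riesz_measure (s k)"
        by (intro integrable_continuous cont riesz.prob_space_axioms) simp
    qed (auto simp: s_def indicator_def)
    finally show "p (Suc k) \<le> (LINT x|riesz_measure. s k x)" .
  qed
  also have "(\<Sum>k<n. LINT x|riesz_measure. s k x) = (LINT x|riesz_measure. n * f x)"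
    unfolding nf
    by (intro Bochner_Integration.integral_sum[symmetric] integrable_continuous cont riesz.prob_space_axioms) simp
  also have "\<dots> = n * (LINT x|riesz_measure. f x)"
    by simp
  finally have "n * L f \<le> 1 + n * (LINT x|riesz_measure. f x)" .
  then have "L f \<le> 1 / n + (LINT x|riesz_measure. f x)"
    using n(1) by (simp add: field_simps)
  then show "L f \<le> (LINT x|riesz_measure. f x) + e"
    using n(2) by simp
qed

text \<open>An affine change moves the values of \<open>f\<close> into the unit interval. Both
  \<open>L\<close> and the integral respect it, being linear and normalized.\<close>

lemma L_le_integral:
  assumes f: "continuous_on UNIV f"
  shows "L f \<le> (LINT x|riesz_measure. f x)"
proof -
  have "bounded (range f)"
    using compact_UNIV f compact_continuous_image compact_imp_bounded by blast
  then obtain b where b: "0 < b" "\<And>x. \<bar>f x\<bar> \<le> b"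
    by (auto simp: bounded_pos)
  let ?g = "\<lambda>x. f x / (2 * b) + 1 / 2"
  have *: "0 \<le> ?g x" "?g x \<le> 1" for x
    using b(1) b(2)[of x] by (auto simp: field_simps)
  have cont: "continuous_on UNIV ?g"
    using f b by (intro continuous_intros) auto
  have "L ?g \<le> (LINT x|riesz_measure. ?g x)"
    using * by (intro L_le_integral_unit cont)
  moreover have "L ?g = L f / (2 * b) + 1 / 2"
    using add[of "\<lambda>x. f x / (2 * b)" "\<lambda>_. 1 / 2"] scale[OF f, of "1 / (2 * b)"]
      continuous_on_mult_left[OF f, of "1 / (2 * b)"]
    by (simp add: const)
  moreover have "(LINT x|riesz_measure. ?g x) = (LINT x|riesz_measure. f x) / (2 * b) + 1 / 2"
    using integrable_continuous[OF riesz.prob_space_axioms sets_riesz_measure f]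
    by (simp add: riesz.prob_space[simplified])
  ultimately show ?thesis
    using b(1) by (simp add: field_simps)
qed

text \<open>The one-sided bound applied to \<open>- f\<close> gives the reverse inequality.\<close>

lemma L_eq_integral:
  assumes f: "continuous_on UNIV f"
  shows "L f = (LINT x|riesz_measure. f x)"
proof (rule antisym)
  show "(LINT x|riesz_measure. f x) \<le> L f"
    using L_le_integral[of "\<lambda>x. - f x"] scale[OF f, of "-1"] f by (simp add: continuous_on_minus)
qed (rule L_le_integral[OF f])

section \<open>Uniqueness of the representing measure\<close>

text \<open>For compact \<open>K\<close> inside \<open>U\<close>, a Urysohn function between the two
  indicators gives \<open>emeasure M K \<le> content U\<close>, and inner regularity passes this on
  to \<open>U\<close>. Conversely, the integral of any function below \<open>U\<close> is at most
  the measure of \<open>U\<close>.\<close>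

lemma emeasure_eq_content:
  assumes reg: "regular_borel_measure M" and "prob_space M"
    and int: "\<And>f. continuous_on UNIV f \<Longrightarrow> L f = (LINT x|M. f x)" and U: "open U"
  shows "emeasure M U = content U"
proof -
  interpret M: prob_space M by fact
  have sets_M [measurable_cong]: "sets M = sets borel"
    using reg by (simp add: regular_borel_measure_def)
  have ind: "integrable M (indicator A :: 'a \<Rightarrow> real)" "(LINT x|M. indicator A x) = M.prob A"
    if "A \<in> sets borel" for A
    using that sets_M by (auto simp: less_top[symmetric] sets_eq_imp_space_eq[OF sets_M])
  show ?thesis
  proof (rule antisym)
    have "emeasure M K \<le> content U" if K: "K \<subseteq> U" "compact K" for K
    proof -
      obtain f :: "'a \<Rightarrow> real" where f: "continuous_on UNIV f" "\<And>x. 0 \<le> f x" "\<And>x. f x \<le> 1"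
        "\<And>x. x \<in> - U \<Longrightarrow> f x = 0" "\<And>x. x \<in> K \<Longrightarrow> f x = 1"
      proof (rule Urysohn_compact_t2[OF compact_UNIV, of "- U" K])
        show "- U \<inter> K = {}"
          using K(1) by blast
      qed (use U compact_imp_closed[OF K(2)] in \<open>auto simp only: closed_Compl\<close>)
      have "M.prob K = (LINT x|M. indicator K x)"
        using ind(2) compact_imp_closed[OF K(2)] by simp
      also have "\<dots> \<le> (LINT x|M. f x)"
        using f compact_imp_closed[OF K(2)]
        by (intro integral_mono ind integrable_continuous sets_M M.prob_space_axioms)
          (auto simp: indicator_def)
      also have "\<dots> = L f"
        using int f by simp
      finally have "emeasure M K \<le> ennreal (L f)"
        by (simp add: M.emeasure_eq_measure ennreal_leI)
      also have "\<dots> \<le> content U"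
        using f by (intro content_upper belowI) auto
      finally show ?thesis .
    qed
    then show "emeasure M U \<le> content U"
      using reg U by (auto simp: regular_borel_measure_def intro!: SUP_least)
    show "content U \<le> emeasure M U"
      unfolding content_def
    proof (rule SUP_least)
      fix f assume f: "f \<in> below U"
      have "L f = (LINT x|M. f x)"
        using int belowD(1)[OF f] .
      also have "\<dots> \<le> (LINT x|M. indicator U x)"
        using belowD[OF f] U
        by (intro integral_mono ind integrable_continuous sets_M M.prob_space_axioms)
          (auto simp: indicator_def)
      also have "\<dots> = M.prob U"
        using ind U by simp
      finally show "ennreal (L f) \<le> emeasure M U"
        by (simp add: M.emeasure_eq_measure ennreal_leI)
    qed
  qed
qed

theorem riesz_representation:
  "\<exists>!M. regular_borel_measure M \<and> prob_space M \<and>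
     (\<forall>f. continuous_on UNIV f \<longrightarrow> L f = (LINT x|M. f x))"
proof (rule ex1I[of _ riesz_measure])
  show "regular_borel_measure riesz_measure \<and> prob_space riesz_measure \<and>
     (\<forall>f. continuous_on UNIV f \<longrightarrow> L f = (LINT x|riesz_measure. f x))"
    using regular_riesz_measure riesz.prob_space_axioms L_eq_integral by blast
next
  fix M assume M: "regular_borel_measure M \<and> prob_space M \<and>
     (\<forall>f. continuous_on UNIV f \<longrightarrow> L f = (LINT x|M. f x))"
  then have sets_M: "sets M = sets borel"
    by (simp add: regular_borel_measure_def)
  show "M = riesz_measure"
  proof (rule measure_eqI)
    fix B assume "B \<in> sets M"
    then have B: "B \<in> sets borel" using sets_M by simp
    then have "emeasure M B = (INF U\<in>{U. B \<subseteq> U \<and> open U}. emeasure M U)"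
      using M unfolding regular_borel_measure_def by blast
    \<comment> \<open>Outer regularity extends the agreement on open sets to all Borel sets.\<close>
    also have "\<dots> = outer B"
      unfolding outer_def using M emeasure_eq_content by (intro INF_cong) auto
    finally show "emeasure M B = emeasure riesz_measure B"
      using B by (simp add: emeasure_riesz_measure)
  qed (simp add: sets_M)
qed

end

section \<open>Transfer to bounded continuous functions\<close>

lemma Bcontfun_inverse_compact:
  fixes f :: "'a::topological_space \<Rightarrow> real"
  assumes "compact (UNIV :: 'a set)" "continuous_on UNIV f"
  shows "apply_bcontfun (Bcontfun f) = f"
  using assms compact_continuous_image[of UNIV f] compact_imp_bounded
  by (auto simp: bcontfun_def intro!: Bcontfun_inverse)

text \<open>Precomposition with \<open>Bcontfun\<close> turns \<mu> into a functional on plain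
  functions. By compactness continuous functions are bounded, so on them \<open>Bcontfun\<close> is
  faithful and the locale laws hold.\<close>

lemma is_probability_measureI:
  fixes \<mu> :: "('a::t2_space \<Rightarrow>\<^sub>C real) \<Rightarrow> real"
  assumes compact: "compact (UNIV :: 'a set)" and lin: "linear \<mu>"
    and pos: "\<And>\<phi>. (\<And>x. 0 \<le> apply_bcontfun \<phi> x) \<Longrightarrow> 0 \<le> \<mu> \<phi>"
    and one: "\<mu> (const_bcontfun 1) = 1"
  shows "is_probability_measure \<mu>"
proof -
  note inv = Bcontfun_inverse_compact[OF compact]
  interpret normalized_positive_functional "\<lambda>f. \<mu> (Bcontfun f)"
  proof
    fix f g :: "'a \<Rightarrow> real" and c :: real
    assume f: "continuous_on UNIV f"
    show "\<mu> (Bcontfun (\<lambda>x. c * f x)) = c * \<mu> (Bcontfun f)"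
    proof -
      have "Bcontfun (\<lambda>x. c * f x) = c *\<^sub>R Bcontfun f"
        using f by (intro bcontfun_eqI) (simp add: inv continuous_on_mult_left)
      then show ?thesis using linear_scale[OF lin] by simp
    qed
    show "0 \<le> \<mu> (Bcontfun f)" if "\<And>x. 0 \<le> f x"
      using pos[of "Bcontfun f"] that f by (simp add: inv)
    assume g: "continuous_on UNIV g"
    have "Bcontfun (\<lambda>x. f x + g x) = Bcontfun f + Bcontfun g"
      using f g by (intro bcontfun_eqI) (simp add: inv continuous_on_add)
    then show "\<mu> (Bcontfun (\<lambda>x. f x + g x)) = \<mu> (Bcontfun f) + \<mu> (Bcontfun g)"
      using linear_add[OF lin] by simp
  next
    show "\<mu> (Bcontfun (\<lambda>_. 1)) = 1"
      using one by (simp add: const_bcontfun_def)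
  qed (rule compact)
  \<comment> \<open>The two representation conditions agree for each \<open>M\<close>, so the unique
    existence carries over.\<close>
  have "(\<forall>f. continuous_on UNIV f \<longrightarrow> \<mu> (Bcontfun f) = (LINT x|M. f x)) \<longleftrightarrow>
      (\<forall>\<phi>. \<mu> \<phi> = (LINT x|M. apply_bcontfun \<phi> x))" for M :: "'a measure"
    using inv by (metis apply_bcontfun_inverse continuous_on_apply_bcontfun)
  then show ?thesis
    using riesz_representation by (simp add: is_probability_measure_def)
qed

section \<open>Slopes at infinity and the dual entropy\<close>

text \<open>The Archimedean property, in the form used to compare slopes along rays.\<close>

lemma nonpos_if_multiples_bounded:
  fixes a b :: real
  assumes "\<And>n::nat. real n * a \<le> b"
  shows "a \<le> 0"
proof (rule ccontr)
  assume "\<not> a \<le> 0"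
  then obtain n :: nat where "b < real n * a"
    using reals_Archimedean3[of a] by auto
  with assms show False by (meson not_le)
qed

text \<open>Exchanges the extended-real infimum for a uniform real lower bound; density of the reals
  supplies \<open>c\<close>.\<close>

lemma minus_infinity_less_dual_entropy_iff:
  "- \<infinity> < dual_entropy lam \<mu> \<longleftrightarrow> (\<exists>c. \<forall>\<phi>. c \<le> lam \<phi> - \<mu> \<phi>)"
proof
  assume "- \<infinity> < dual_entropy lam \<mu>"
  then obtain c where c: "ereal c < dual_entropy lam \<mu>"
    using ereal_dense2 by blast
  have "ereal c \<le> ereal (lam \<phi> - \<mu> \<phi>)" for \<phi>
    using less_INF_D[OF c[unfolded dual_entropy_def], of \<phi>] by simp
  then show "\<exists>c. \<forall>\<phi>. c \<le> lam \<phi> - \<mu> \<phi>" by auto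
next
  assume "\<exists>c. \<forall>\<phi>. c \<le> lam \<phi> - \<mu> \<phi>"
  then obtain c where "\<And>\<phi>. c \<le> lam \<phi> - \<mu> \<phi>" by blast
  then have "ereal c \<le> dual_entropy lam \<mu>"
    unfolding dual_entropy_def by (intro INF_greatest) simp
  then show "- \<infinity> < dual_entropy lam \<mu>"
    by (rule less_le_trans[rotated]) simp
qed

text \<open>Stated for linear \<mu>, the common ground of bounded functionals and
  subgradients.\<close>

lemma probability_and_invariant_if_finite_entropy:
  fixes \<alpha> :: "'a::t2_space \<Rightarrow> 'a" and lam :: "('a \<Rightarrow>\<^sub>C real) \<Rightarrow> real"
  assumes compact: "compact (UNIV :: 'a set)" and \<alpha>: "continuous_on UNIV \<alpha>"
    and lam: "dynamical_potential \<alpha> lam"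
    and lin: "linear \<mu>" and fin: "- \<infinity> < dual_entropy lam \<mu>"
  shows "is_probability_measure \<mu> \<and> invariant_functional \<alpha> \<mu>"
proof
  obtain c where c: "\<And>\<phi>. c \<le> lam \<phi> - \<mu> \<phi>"
    using fin unfolding minus_infinity_less_dual_entropy_iff by blast
  note [simp] = linear_add[OF lin] linear_diff[OF lin] linear_scale[OF lin] linear_neg[OF lin]
    linear_0[OF lin]
  \<comment> \<open>Along such a ray the entropy bound reads
    \<open>c \<le> lam 0 - n * \<mu> \<phi>\<close> for every \<open>n\<close>.\<close>
  have bounded_ray: "\<mu> \<phi> \<le> 0" if "\<And>n::nat. lam (real n *\<^sub>R \<phi>) \<le> lam 0" for \<phi>
  proof (rule nonpos_if_multiples_bounded)
    show "real n * \<mu> \<phi> \<le> lam 0 - c" for n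
      using that[of n] c[of "real n *\<^sub>R \<phi>"] by simp
  qed
  have inv: "\<mu> (\<phi> - compose_bcontfun \<phi> \<alpha>) \<le> 0" for \<phi>
  proof (rule bounded_ray)
    fix n :: nat
    let ?\<psi> = "real n *\<^sub>R \<phi>"
    have comp: "compose_bcontfun ?\<psi> \<alpha> = real n *\<^sub>R compose_bcontfun \<phi> \<alpha>"
      by (intro bcontfun_eqI) (simp add: apply_compose_bcontfun[OF \<alpha>])
    \<comment> \<open>Strong invariance at the base point \<open>- (\<psi> \<circ> \<alpha>)\<close>
      replaces \<open>?\<psi>\<close> by \<open>\<psi> \<circ> \<alpha>\<close>, and the argument
      collapses to 0.\<close>
    have "lam (- compose_bcontfun ?\<psi> \<alpha> + ?\<psi>) = lam (- compose_bcontfun ?\<psi> \<alpha> + compose_bcontfun ?\<psi> \<alpha>)"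
      using lam unfolding dynamical_potential_def by blast
    then show "lam (real n *\<^sub>R (\<phi> - compose_bcontfun \<phi> \<alpha>)) \<le> lam 0"
      by (simp add: comp scaleR_diff_right)
  qed
  show "invariant_functional \<alpha> \<mu>"
    unfolding invariant_functional_def
  proof
    fix \<phi>
    \<comment> \<open>Replacing \<phi> by its negative gives the opposite inequality.\<close>
    have "compose_bcontfun (- \<phi>) \<alpha> = - compose_bcontfun \<phi> \<alpha>"
      by (intro bcontfun_eqI) (simp add: apply_compose_bcontfun[OF \<alpha>])
    then show "\<mu> (compose_bcontfun \<phi> \<alpha>) = \<mu> \<phi>"
      using inv[of \<phi>] inv[of "- \<phi>"] by simp
  qed
  show "is_probability_measure \<mu>"
  proof (rule is_probability_measureI[OF compact lin])
    fix \<phi> :: "'a \<Rightarrow>\<^sub>C real"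
    assume nonneg: "\<And>x. 0 \<le> apply_bcontfun \<phi> x"
    have "\<mu> (- \<phi>) \<le> 0"
    proof (rule bounded_ray)
      fix n :: nat
      have "\<forall>x. apply_bcontfun (real n *\<^sub>R - \<phi>) x \<le> apply_bcontfun 0 x"
        using nonneg by simp
      then show "lam (real n *\<^sub>R - \<phi>) \<le> lam 0"
        using lam unfolding dynamical_potential_def by blast
    qed
    then show "0 \<le> \<mu> \<phi>" by simp
  next
    \<comment> \<open>Letting \<open>t\<close> run through both \<open>n\<close> and
      \<open>- n\<close> forces the value at the constant 1 to equal the slope 1 of
      \<open>lam\<close>.\<close>
    have "c \<le> lam 0 + t - t * \<mu> (const_bcontfun 1)" for t
    proof -
      have "lam (0 + const_bcontfun t) = lam 0 + t"
        using lam unfolding dynamical_potential_def by blast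
      moreover have "const_bcontfun t = t *\<^sub>R (const_bcontfun 1 :: 'a \<Rightarrow>\<^sub>C real)"
        by (intro bcontfun_eqI) simp
      ultimately show ?thesis
        using c[of "const_bcontfun t"] by simp
    qed
    note this[of "real _"] this[of "- real _"]
    then have "real n * (\<mu> (const_bcontfun 1) - 1) \<le> lam 0 - c"
      "real n * (1 - \<mu> (const_bcontfun 1)) \<le> lam 0 - c" for n
      by (simp_all add: algebra_simps)
    then show "\<mu> (const_bcontfun 1) = 1"
      using nonpos_if_multiples_bounded[of "\<mu> (const_bcontfun 1) - 1"]
        nonpos_if_multiples_bounded[of "1 - \<mu> (const_bcontfun 1)"] by fastforce
  qed
qed

theorem proposition1p2:
  fixes \<alpha> :: "'a::t2_space \<Rightarrow> 'a"
    and lam :: "('a \<Rightarrow>\<^sub>C real) \<Rightarrow> real"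
  assumes "compact (UNIV :: 'a set)"
    and "continuous_on UNIV \<alpha>"
    and "dynamical_potential \<alpha> lam"
  shows "(\<forall>\<mu>. bounded_linear \<mu> \<and> dual_entropy lam \<mu> > -\<infinity>
            \<longrightarrow> is_probability_measure \<mu> \<and> invariant_functional \<alpha> \<mu>)
       \<and> (\<forall>\<phi> \<mu>. equilibrium_measure lam \<phi> \<mu>
            \<longrightarrow> is_probability_measure \<mu> \<and> invariant_functional \<alpha> \<mu>)"
proof (rule conjI; intro allI impI)
  fix \<mu> assume "bounded_linear \<mu> \<and> - \<infinity> < dual_entropy lam \<mu>"
  then show "is_probability_measure \<mu> \<and> invariant_functional \<alpha> \<mu>"
    using probability_and_invariant_if_finite_entropy[OF assms] bounded_linear.linear by blast
next
  fix \<phi> \<mu> assume eq: "equilibrium_measure lam \<phi> \<mu>"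
  then have lin: "linear \<mu>"
    by (simp add: equilibrium_measure_def)
  \<comment> \<open>The subgradient inequality in the direction \<open>\<psi> - \<phi>\<close> shows
    that the infimum is attained at \<phi>, hence finite.\<close>
  have "lam \<phi> - \<mu> \<phi> \<le> lam \<psi> - \<mu> \<psi>" for \<psi>
    using eq[unfolded equilibrium_measure_def, THEN conjunct2, rule_format, of "\<psi> - \<phi>"]
    by (simp add: linear_diff[OF lin])
  then have "- \<infinity> < dual_entropy lam \<mu>"
    unfolding minus_infinity_less_dual_entropy_iff by blast
  then show "is_probability_measure \<mu> \<and> invariant_functional \<alpha> \<mu>"
    using probability_and_invariant_if_finite_entropy[OF assms lin] by blast
qed

end
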